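(* Let $m\ge2$, $n\ge1$ and suppose that $\mathcal{A}=(a_{i_1\cdots i_m})\in T_{m,n}$ is a $Z$-tensor. Then $\mathcal{A}$ is a doubly $B$-tensor if and only if $\mathcal{A}$ is strictly doubly diagonally dominated.
   Context: $[n]=\{1,\dots,n\}$. $T_{m,n}$ is the set of real $m$th order $n$-dimensional tensors $\mathcal{A}=(a_{i_1\cdots i_m})$, $i_1,\dots,i_m\in[n]$. For $i\in[n]$, $r_i^+=\max\{0,\,a_{ij_2\cdots j_m}:(j_2,\dots,j_m)\ne(i,\dots,i)\}$. $\mathcal{A}$ is a $Z$-tensor if all its off-diagonal entries are non-positive, i.e. $a_{ii_2\cdots i_m}\le 0$ for all $i\in[n]$ and $(i_2,\dots,i_m)\neq(i,\dots,i)$. $\mathcal{A}$ is a doubly $B$-tensor if (1) $a_{i\cdots i}>r_i^+$ for all $i\in[n]$, and (2) for all $i\ne j$ in $[n]$, $$(a_{i\cdots i}-r_i^+)(a_{j\cdots j}-r_j^+)>\sum_{(i_2,\dots,i_m)\ne(i,\dots,i)}(r_i^+-a_{ii_2\cdots i_m})\sum_{(j_2,\dots,j_m)\ne(j,\dots,j)}(r_j^+-a_{jj_2\cdots j_m}).$$ $\mathcal{A}$ is strictly doubly diagonally dominated if $a_{ii\cdots i}>0$ for all $i\in[n]$ and for all $i\ne j$ in $[n]$, $$a_{ii\cdots i}a_{jj\cdots j}>\sum_{(i_2,\dots,i_m)\ne(i,\dots,i)}|a_{ii_2\cdots i_m}|\sum_{(j_2,\dots,j_m)\ne(j,\dots,j)}|a_{jj_2\cdots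 j_m}|.$$ *)

theory Defs
  imports Complex_Main "HOL-Library.FuncSet"
begin

(* An m-th order n-dimensional tensor is a function on index words
   [i_1, ..., i_m] over {1..n}, extended by undefined outside the index set. *)

definition index_words :: "nat \<Rightarrow> nat \<Rightarrow> nat list set" where
  "index_words m n = {is. length is = m \<and> set is \<subseteq> {1..n}}"

definition tensors :: "nat \<Rightarrow> nat \<Rightarrow> (nat list \<Rightarrow> real) set" where
  "tensors m n = index_words m n \<rightarrow>\<^sub>E UNIV"

(* Tails (i_2, ..., i_m) different from (i, ..., i): the tensor entry belonging to
   a tail js of row i is A (i # js). *)
definition offdiag_tails :: "nat \<Rightarrow> nat \<Rightarrow> nat \<Rightarrow> nat list set" where
  "offdiag_tails m n i = index_words (m - 1) n - {replicate (m - 1) i}"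

definition diag_entry :: "nat \<Rightarrow> (nat list \<Rightarrow> real) \<Rightarrow> nat \<Rightarrow> real" where
  "diag_entry m A i = A (replicate m i)"

definition r_plus :: "nat \<Rightarrow> nat \<Rightarrow> (nat list \<Rightarrow> real) \<Rightarrow> nat \<Rightarrow> real" where
  "r_plus m n A i = Max (insert 0 ((\<lambda>js. A (i # js)) ` offdiag_tails m n i))"

definition Z_tensor :: "nat \<Rightarrow> nat \<Rightarrow> (nat list \<Rightarrow> real) \<Rightarrow> bool" where
  "Z_tensor m n A \<longleftrightarrow> (\<forall>i\<in>{1..n}. \<forall>js\<in>offdiag_tails m n i. A (i # js) \<le> 0)"

definition doubly_B_tensor :: "nat \<Rightarrow> nat \<Rightarrow> (nat list \<Rightarrow> real) \<Rightarrow> bool" where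
  "doubly_B_tensor m n A \<longleftrightarrow>
     (\<forall>i\<in>{1..n}. diag_entry m A i > r_plus m n A i) \<and>
     (\<forall>i\<in>{1..n}. \<forall>j\<in>{1..n}. i \<noteq> j \<longrightarrow>
        (diag_entry m A i - r_plus m n A i) * (diag_entry m A j - r_plus m n A j) >
        (\<Sum>is\<in>offdiag_tails m n i. r_plus m n A i - A (i # is)) *
        (\<Sum>js\<in>offdiag_tails m n j. r_plus m n A j - A (j # js)))"

definition strictly_doubly_diagonally_dominated ::
    "nat \<Rightarrow> nat \<Rightarrow> (nat list \<Rightarrow> real) \<Rightarrow> bool" where
  "strictly_doubly_diagonally_dominated m n A \<longleftrightarrow>
     (\<forall>i\<in>{1..n}. diag_entry m A i > 0) \<and>
     (\<forall>i\<in>{1..n}. \<forall>j\<in>{1..n}. i \<noteq> j \<longrightarrow>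
        diag_entry m A i * diag_entry m A j >
        (\<Sum>is\<in>offdiag_tails m n i. \<bar>A (i # is)\<bar>) *
        (\<Sum>js\<in>offdiag_tails m n j. \<bar>A (j # js)\<bar>))"

(* Finiteness makes the maximum and the sums above genuine. *)
lemma finite_offdiag_tails: "finite (offdiag_tails m n i)"
proof -
  have "finite {is :: nat list. set is \<subseteq> {1..n} \<and> length is = m - 1}"
    by (rule finite_lists_length_eq) simp
  then show ?thesis
    by (simp add: offdiag_tails_def index_words_def conj_commute)
qed

end

theory Submission
  imports Defs
begin

text \<open>Off-diagonal entries a of a Z-tensor are non-positive, so the maximum in
  \<open>r_plus\<close> is the inserted 0, and each summand \<open>r_plus\<close> - a becomes -a =
  |a|. The two definitions then agree inequality by inequality.\<close>

lemma Z_tensor_r_plus: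
  assumes "Z_tensor m n A" and "i \<in> {1..n}"
  shows "r_plus m n A i = 0"
  unfolding r_plus_def
  by (rule Max_eqI) (use assms finite_offdiag_tails in \<open>auto simp: Z_tensor_def\<close>)

lemma Z_tensor_abs_offdiag_sum:
  assumes "Z_tensor m n A" and "i \<in> {1..n}"
  shows "(\<Sum>js\<in>offdiag_tails m n i. \<bar>A (i # js)\<bar>) = (\<Sum>js\<in>offdiag_tails m n i. - A (i # js))"
  by (rule sum.cong) (use assms in \<open>auto simp: Z_tensor_def\<close>)

theorem proposition3:
  fixes m n :: nat and A :: "nat list \<Rightarrow> real"
  assumes "m \<ge> 2" and "n \<ge> 1"
    and "A \<in> tensors m n"
    and "Z_tensor m n A"
  shows "doubly_B_tensor m n A \<longleftrightarrow> strictly_doubly_diagonally_dominated m n A"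
  unfolding doubly_B_tensor_def strictly_doubly_diagonally_dominated_def
  \<comment> \<open>Keeping \<open>{1..n}\<close> unexpanded lets the assumptions from the bounded
    quantifiers match the side conditions of both rewrite rules.\<close>
  using assms(4) by (simp add: Z_tensor_r_plus Z_tensor_abs_offdiag_sum del: atLeastAtMost_iff)

end
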